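(* Let $n\ge2$, $0<s<1$, $0<p<\infty$, $sp<n$ and $\frac{np}{n-sp}\le q<\infty$, and let $u\in\dot{W}^{s,p}_q(\mathbb{R}^n)$. Then there is $K\in\mathbb{R}$ such that $u(x)=K$ for almost every $x\in\mathbb{R}^n$.
   Context: $u\in\dot{W}^{s,p}_q(\mathbb{R}^n)$ means that $u:\mathbb{R}^n\to\mathbb{R}$ is measurable and $\int_{\mathbb{R}^n}\Big(\int_{\mathbb{R}^n}\frac{|u(x)-u(y)|^q}{|x-y|^{n+sq}}\,dy\Big)^{p/q}dx<\infty$. *)

theory Defs
  imports "HOL-Analysis.Analysis"
begin

text \<open>Real powers of extended nonnegative reals, meant for exponents \<open>r > 0\<close>:
  \<open>\<infinity>\<close> is mapped to \<open>\<infinity>\<close> (and \<open>0\<close> to \<open>0\<close>), so an infinite inner integral below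
  is not collapsed to a finite value.\<close>

definition ennreal_powr :: "ennreal \<Rightarrow> real \<Rightarrow> ennreal" where
  "ennreal_powr a r = (if a = \<infinity> then \<infinity> else ennreal (enn2real a powr r))"

text \<open>Measurable means Lebesgue measurable. At \<open>y = x\<close> the integrand is \<open>0 / 0 = 0\<close>,
  which is irrelevant since a point is a null set.\<close>

definition hom_Sobolev :: "real \<Rightarrow> real \<Rightarrow> real \<Rightarrow> (real ^ 'n \<Rightarrow> real) set" where
  "hom_Sobolev s p q = {u. u \<in> borel_measurable lebesgue \<and>
     (\<integral>\<^sup>+ x. ennreal_powr
        (\<integral>\<^sup>+ y. ennreal (\<bar>u x - u y\<bar> powr q / norm (x - y) powr (real CARD('n) + s * q)) \<partial>lebesgue)
        (p / q) \<partial>lebesgue) < \<infinity>}"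

end

theory Submission
  imports Defs
begin

text \<open>
  Write \<open>n\<close> for the dimension and \<open>I x\<close> for the inner integral at \<open>x\<close>. The point is that a
  nonconstant \<open>u\<close> makes \<open>I x\<close> decay too slowly at infinity.

  If \<open>u\<close> is not almost everywhere constant, there are two levels \<open>a < b\<close> such that both
  \<open>u \<le> a\<close> and \<open>u \<ge> b\<close> hold on sets of positive measure (\<open>AE_const_or_level_gap\<close>), and both
  sets can be taken inside one ball of radius \<open>R\<close> (\<open>not_AE_on_some_ball\<close>). Whatever the
  value \<open>u x\<close> is, it is at distance at least \<open>(b - a) / 2\<close> from \<open>u y\<close> for all \<open>y\<close> in one of
  the two sets. Since \<open>|x - y| \<le> |x| + R\<close> there, this gives
  \<open>I x \<ge> m / (|x| + R) powr (n + s * q)\<close> for every \<open>x\<close>, with one constant \<open>m > 0\<close>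
  (\<open>inner_integral_lower_bound\<close>).

  Raising to the power \<open>p / q\<close> turns the decay exponent into \<open>n * p / q + s * p\<close>, and the
  hypothesis \<open>q \<ge> n * p / (n - s * p)\<close> says exactly that this exponent is at most \<open>n\<close>. But
  \<open>(|x| + R) powr (- n)\<close> already has infinite integral over the whole space
  (\<open>nn_integral_inverse_norm_power_DIM\<close>), so the seminorm of \<open>u\<close> cannot be finite.
\<close>

section \<open>Level sets of nonconstant functions\<close>

text \<open>
  The constant is the essential infimum \<open>K\<close> of \<open>u\<close>, the supremum of the levels that \<open>u\<close>
  exceeds almost everywhere. A level above \<open>K\<close> is not exceeded almost everywhere, so by the
  hypothesis \<open>u\<close> is almost everywhere below every still larger level. If \<open>K\<close> were infinite,
  the measure would be zero and there is nothing to prove.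
\<close>

lemma AE_const_or_level_gap:
  fixes u :: "'a \<Rightarrow> real"
  assumes no_gap: "\<And>a b. a < b \<Longrightarrow> (AE x in M. a < u x) \<or> (AE x in M. u x < b)"
  shows "\<exists>K. AE x in M. u x = K"
proof -
  define S where "S = {a. AE x in M. a < u x}"
  show ?thesis
  proof (cases "S = {} \<or> \<not> bdd_above S")
    case True
    have "AE x in M. False"
      using True
    proof
      assume "S = {}"
      then have "AE x in M. u x < real_of_int k" for k :: int
        using no_gap[of "real_of_int k - 1" "real_of_int k"] by (auto simp: S_def)
      then have "AE x in M. \<forall>k::int. u x < real_of_int k"
        by (simp add: AE_all_countable)
      then show ?thesis
        by eventually_elim (use of_int_floor_le not_less in blast)
    next
      assume nb: "\<not> bdd_above S"
      have "AE x in M. real n < u x" for n :: nat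
      proof -
        from nb obtain a where "a \<in> S" "real n < a"
          unfolding bdd_above_def by (meson not_le)
        then show ?thesis unfolding S_def by auto
      qed
      then have "AE x in M. \<forall>n::nat. real n < u x"
        by (simp add: AE_all_countable)
      then show ?thesis
        by eventually_elim (use reals_Archimedean2 less_asym in blast)
    qed
    then show ?thesis by auto
  next
    case False
    then have ne: "S \<noteq> {}" and bdd: "bdd_above S" by auto
    define K where "K = Sup S"
    have "AE x in M. K - 1 / real (Suc n) < u x" for n
    proof -
      have "K - 1 / real (Suc n) < Sup S" by (simp add: K_def)
      then obtain a where "a \<in> S" "K - 1 / real (Suc n) < a"
        using less_cSup_iff[OF ne bdd] by blast
      then show ?thesis unfolding S_def by auto
    qed
    then have lower: "AE x in M. \<forall>n. K - 1 / real (Suc n) < u x"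
      by (simp add: AE_all_countable)
    have "AE x in M. u x < K + 1 / real (Suc n)" for n
    proof -
      define a where "a = K + 1 / real (Suc n) / 2"
      have "K < a" by (simp add: a_def)
      then have "a \<notin> S" using cSup_upper[OF _ bdd] K_def by force
      moreover have "a < K + 1 / real (Suc n)" unfolding a_def by (simp add: field_simps)
      ultimately show ?thesis using no_gap unfolding S_def by blast
    qed
    then have upper: "AE x in M. \<forall>n. u x < K + 1 / real (Suc n)"
      by (simp add: AE_all_countable)
    have "AE x in M. u x = K"
      using lower upper
    proof eventually_elim
      fix x assume x: "\<forall>n. K - 1 / real (Suc n) < u x" "\<forall>n. u x < K + 1 / real (Suc n)"
      show "u x = K"
      proof (rule ccontr)
        assume "u x \<noteq> K"
        then obtain n where "1 / real (Suc n) < \<bar>u x - K\<bar>"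
          using nat_approx_posE[of "\<bar>u x - K\<bar>"] by auto
        moreover have "\<bar>u x - K\<bar> < 1 / real (Suc n)"
          using x(1)[rule_format, of n] x(2)[rule_format, of n] by linarith
        ultimately show False by simp
      qed
    qed
    then show ?thesis by blast
  qed
qed

text \<open>
  Countably many balls exhaust the space, so a set that is not null meets one of them in a set
  that is not null. All larger radii are included so that two sets can share a ball.
\<close>

lemma not_AE_on_some_ball:
  fixes P :: "'a::euclidean_space \<Rightarrow> bool"
  assumes "\<not> (AE x in M. \<not> P x)"
  shows "\<exists>N::nat. \<forall>R\<ge>real N. \<not> (AE x in M. \<not> (norm x < R \<and> P x))"
proof (rule ccontr)
  assume "\<not> ?thesis"
  then have far: "\<forall>N::nat. \<exists>R\<ge>real N. AE x in M. \<not> (norm x < R \<and> P x)" by blast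
  have "AE x in M. \<not> (norm x < real N \<and> P x)" for N :: nat
  proof -
    from far obtain R where "R \<ge> real N" "AE x in M. \<not> (norm x < R \<and> P x)"
      by blast
    from this(2) show ?thesis
      by eventually_elim (use \<open>R \<ge> real N\<close> in auto)
  qed
  then have "AE x in M. \<forall>N::nat. \<not> (norm x < real N \<and> P x)"
    unfolding AE_all_countable by blast
  then have "AE x in M. \<not> P x"
    by eventually_elim (use reals_Archimedean2 in blast)
  with assms show False by blast
qed

section \<open>The critical power at infinity\<close>

text \<open>
  On the dyadic annulus between the radii \<open>R * 2 ^ k\<close> and \<open>R * 2 ^ (k + 1)\<close> the
  integrand is comparable to the reciprocal of the volume of the annulus. Hence each of these
  infinitely many disjoint annuli contributes at least the same positive amount.
\<close>

lemma nn_integral_inverse_norm_power_DIM: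
  fixes R :: real
  assumes "R > 0"
  shows "(\<integral>\<^sup>+ x. ennreal (1 / (norm (x::'a::euclidean_space) + R) ^ DIM('a)) \<partial>lborel) = \<infinity>"
proof -
  define n where "n = DIM('a)"
  define f where "f = (\<lambda>x::'a. ennreal (1 / (norm x + R) ^ n))"
  define A where "A = (\<lambda>k::nat. ball (0::'a) (R * 2 ^ Suc k) - ball 0 (R * 2 ^ k))"
  define v where "v = unit_ball_vol (real n)"
  have n: "n \<ge> 1" unfolding n_def by (simp add: Suc_leI)
  have v: "v > 0" unfolding v_def by simp
  have [measurable]: "f \<in> borel_measurable lborel" unfolding f_def by measurable
  have [measurable, simp]: "A k \<in> sets borel" for k unfolding A_def by auto
  have mass: "ennreal (v / 4 ^ n) \<le> emeasure (density lborel f) (A k)" for k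
  proof -
    have sub: "ball (0::'a) (R * 2 ^ k) \<subseteq> ball 0 (R * 2 ^ Suc k)"
      using assms by (intro subset_ball) auto
    have "emeasure lborel (A k) = emeasure lborel (ball (0::'a) (R * 2 ^ Suc k)) - emeasure lborel (ball (0::'a) (R * 2 ^ k))"
      unfolding A_def by (rule emeasure_Diff) (use sub emeasure_lborel_ball_finite[of "0::'a" "R * 2 ^ k"] in \<open>auto simp: less_top\<close>)
    also have "\<dots> = ennreal (v * (R * 2 ^ Suc k) ^ n) - ennreal (v * (R * 2 ^ k) ^ n)"
      using assms by (simp add: emeasure_ball v_def n_def)
    also have "\<dots> = ennreal (v * (R * 2 ^ Suc k) ^ n - v * (R * 2 ^ k) ^ n)"
      using assms v by (intro ennreal_minus) auto
    finally have eA: "emeasure lborel (A k) = ennreal (v * (R * 2 ^ Suc k) ^ n - v * (R * 2 ^ k) ^ n)" .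
    have "(2::real) \<le> 2 ^ n" using n by (simp add: self_le_power)
    then have "2 * (v * (R * 2 ^ k) ^ n) \<le> 2 ^ n * (v * (R * 2 ^ k) ^ n)"
      using v assms by (intro mult_right_mono) auto
    also have "\<dots> = v * (R * 2 ^ Suc k) ^ n" by (simp add: power_mult_distrib)
    finally have "ennreal (v * (R * 2 ^ k) ^ n) \<le> emeasure lborel (A k)"
      unfolding eA by (intro ennreal_leI) auto
    then have "ennreal (1 / (4 * (R * 2 ^ k)) ^ n) * ennreal (v * (R * 2 ^ k) ^ n)
        \<le> ennreal (1 / (4 * (R * 2 ^ k)) ^ n) * emeasure lborel (A k)"
      by (rule mult_left_mono) simp
    also have "\<dots> = (\<integral>\<^sup>+ x. ennreal (1 / (4 * (R * 2 ^ k)) ^ n) * indicator (A k) x \<partial>lborel)"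
      by (rule nn_integral_cmult_indicator[symmetric]) measurable
    also have "\<dots> \<le> (\<integral>\<^sup>+ x. f x * indicator (A k) x \<partial>lborel)"
    proof (intro nn_integral_mono)
      fix x :: 'a
      have "1 / (4 * (R * 2 ^ k)) ^ n \<le> 1 / (norm x + R) ^ n" if "x \<in> A k"
      proof -
        have "R \<le> R * 2 ^ k" using assms by simp
        moreover have "norm x < 2 * (R * 2 ^ k)" using that by (simp add: A_def mult_ac)
        ultimately have "norm x + R \<le> 4 * (R * 2 ^ k)" using norm_ge_zero[of x] by linarith
        then have "(norm x + R) ^ n \<le> (4 * (R * 2 ^ k)) ^ n"
          using assms by (intro power_mono) auto
        then show ?thesis using assms by (intro divide_left_mono) (auto intro!: mult_pos_pos zero_less_power add_nonneg_pos)
      qed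
      then show "ennreal (1 / (4 * (R * 2 ^ k)) ^ n) * indicator (A k) x \<le> f x * indicator (A k) x"
        by (auto simp: f_def indicator_def intro!: ennreal_leI)
    qed
    also have "\<dots> = emeasure (density lborel f) (A k)"
      by (rule emeasure_density[symmetric]) measurable
    also have "ennreal (1 / (4 * (R * 2 ^ k)) ^ n) * ennreal (v * (R * 2 ^ k) ^ n) = ennreal (v / 4 ^ n)"
      using assms v by (subst ennreal_mult[symmetric]) (auto simp: power_mult_distrib)
    finally show ?thesis .
  qed
  have disj: "disjoint_family A"
    unfolding disjoint_family_on_def
  proof (intro ballI impI)
    have "A j \<inter> A k = {}" if "j < k" for j k
    proof -
      have "(2::real) ^ Suc j \<le> 2 ^ k" using that by (intro power_increasing) auto
      then have "R * 2 ^ Suc j \<le> R * 2 ^ k" using assms by (simp only: mult_le_cancel_left_pos)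
      then show ?thesis unfolding A_def by (fastforce)
    qed
    then show "A j \<inter> A k = {}" if "j \<noteq> k" for j k
      using that by (metis inf_commute linorder_neqE_nat)
  qed
  have "\<infinity> = (\<integral>\<^sup>+ k. ennreal (v / 4 ^ n) \<partial>count_space (UNIV::nat set))"
    using v by (simp add: ennreal_mult_top)
  also have "\<dots> = (\<Sum>k. ennreal (v / 4 ^ n))"
    by (rule nn_integral_count_space_nat)
  also have "\<dots> \<le> (\<Sum>k. emeasure (density lborel f) (A k))"
    by (intro suminf_le mass) auto
  also have "\<dots> = emeasure (density lborel f) (\<Union>k. A k)"
    by (rule suminf_emeasure) (use disj in auto)
  also have "\<dots> \<le> emeasure (density lborel f) (space lborel)"
    by (rule emeasure_mono) auto
  also have "\<dots> = (\<integral>\<^sup>+ x. f x \<partial>lborel)"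
    by (simp add: emeasure_density)
  finally show ?thesis by (simp add: f_def n_def top_unique)
qed

section \<open>Slow decay of the inner integral\<close>

text \<open>
  No value \<open>u x\<close> can be close both to the values at most \<open>a\<close> and to those at least \<open>b\<close>, so for
  each \<open>x\<close> one of the two sets gives a contribution. A positive lower bound for both measures makes
  the constant \<open>m\<close> independent of \<open>x\<close>.
\<close>

lemma inner_integral_lower_bound:
  fixes u :: "'a::euclidean_space \<Rightarrow> real"
  assumes [measurable]: "u \<in> borel_measurable lebesgue"
    and "a < b" and "q > 0" and "r > 0" and "R > 0"
    and low: "\<not> (AE x in lebesgue. \<not> (norm x < R \<and> u x \<le> a))"
    and high: "\<not> (AE x in lebesgue. \<not> (norm x < R \<and> b \<le> u x))"
  shows "\<exists>m>0. \<forall>x. ennreal (m / (norm x + R) powr r)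
    \<le> (\<integral>\<^sup>+ y. ennreal (\<bar>u x - u y\<bar> powr q / norm (x - y) powr r) \<partial>lebesgue)"
proof -
  define e where "e = (b - a) / 2"
  have e: "e > 0" using \<open>a < b\<close> by (simp add: e_def)
  define L where "L = {y. norm y < R \<and> u y \<le> a}"
  define H where "H = {y. norm y < R \<and> b \<le> u y}"
  have [measurable]: "(\<lambda>y::'a. norm y) \<in> borel_measurable lebesgue"
    by (intro borel_measurable_continuous_onI measurable_completion) (auto intro!: continuous_intros)
  have meas: "L \<in> sets lebesgue" "H \<in> sets lebesgue"
  proof -
    have "{y \<in> space lebesgue. norm y < R \<and> u y \<le> a} \<in> sets lebesgue"
      "{y \<in> space lebesgue. norm y < R \<and> b \<le> u y} \<in> sets lebesgue" by measurable
    then show "L \<in> sets lebesgue" "H \<in> sets lebesgue" by (simp_all add: L_def H_def)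
  qed
  have pos: "emeasure lebesgue L > 0" "emeasure lebesgue H > 0"
    using low high AE_iff_measurable[OF meas(1), of "\<lambda>y. \<not> (norm y < R \<and> u y \<le> a)"]
      AE_iff_measurable[OF meas(2), of "\<lambda>y. \<not> (norm y < R \<and> b \<le> u y)"]
    by (auto simp: L_def H_def zero_less_iff_neq_zero)
  \<comment> \<open>A real lower bound for both measures, which avoids treating infinite measure apart.\<close>
  obtain d where d: "0 < d" "ennreal d \<le> emeasure lebesgue L" "ennreal d \<le> emeasure lebesgue H"
  proof -
    have "0 < min (emeasure lebesgue L) (emeasure lebesgue H)" using pos by simp
    then obtain z where z: "0 < z" "z < min (emeasure lebesgue L) (emeasure lebesgue H)"
      using dense by blast
    then have "z < top" using less_top_ennreal order_less_le_trans top_greatest by (metis z(2))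
    then obtain d where "z = ennreal d" "0 \<le> d" by (cases z) auto
    with z show ?thesis by (intro that[of d]) auto
  qed
  have "ennreal (e powr q * d / (norm x + R) powr r)
      \<le> (\<integral>\<^sup>+ y. ennreal (\<bar>u x - u y\<bar> powr q / norm (x - y) powr r) \<partial>lebesgue)" for x
  proof -
    obtain E where E: "E \<in> sets lebesgue" "ennreal d \<le> emeasure lebesgue E"
      "\<And>y. y \<in> E \<Longrightarrow> norm y < R \<and> e \<le> \<bar>u x - u y\<bar>"
    proof (cases "u x \<le> (a + b) / 2")
      case True
      show ?thesis
      proof (rule that[of H])
        fix y assume "y \<in> H"
        with True show "norm y < R \<and> e \<le> \<bar>u x - u y\<bar>"
          unfolding H_def e_def by (simp add: abs_if field_simps)
      qed (fact meas d)+
    next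
      case False
      show ?thesis
      proof (rule that[of L])
        fix y assume "y \<in> L"
        with False show "norm y < R \<and> e \<le> \<bar>u x - u y\<bar>"
          unfolding L_def e_def by (simp add: abs_if field_simps)
      qed (fact meas d)+
    qed
    have bound: "e powr q / (norm x + R) powr r \<le> \<bar>u x - u y\<bar> powr q / norm (x - y) powr r"
      if "y \<in> E" for y
    proof -
      from E(3)[OF that] have y: "norm y < R" "e \<le> \<bar>u x - u y\<bar>" by auto
      \<comment> \<open>On the diagonal the integrand is \<open>0 / 0 = 0\<close>, so the estimate needs \<open>x \<noteq> y\<close>.\<close>
      then have "x \<noteq> y" using e by auto
      have "norm (x - y) \<le> norm x + R" using norm_triangle_ineq4[of x y] y by linarith
      then have "norm (x - y) powr r \<le> (norm x + R) powr r"
        using \<open>r > 0\<close> by (intro powr_mono2) auto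
      moreover have "e powr q \<le> \<bar>u x - u y\<bar> powr q"
        using y e \<open>q > 0\<close> by (intro powr_mono2) auto
      ultimately show ?thesis using \<open>x \<noteq> y\<close> by (intro frac_le) auto
    qed
    have "ennreal (e powr q * d / (norm x + R) powr r)
        = ennreal (e powr q / (norm x + R) powr r) * ennreal d"
      using d by (subst ennreal_mult[symmetric]) auto
    also have "\<dots> \<le> ennreal (e powr q / (norm x + R) powr r) * emeasure lebesgue E"
      by (intro mult_left_mono E) simp
    also have "\<dots> = (\<integral>\<^sup>+ y. ennreal (e powr q / (norm x + R) powr r) * indicator E y \<partial>lebesgue)"
      using E(1) by (simp add: nn_integral_cmult_indicator)
    also have "\<dots> \<le> (\<integral>\<^sup>+ y. ennreal (\<bar>u x - u y\<bar> powr q / norm (x - y) powr r) \<partial>lebesgue)"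
      by (intro nn_integral_mono) (auto simp: indicator_def intro!: ennreal_leI bound)
    finally show ?thesis .
  qed
  moreover have "e powr q * d > 0" using e d by simp
  ultimately show ?thesis by blast
qed

lemma ennreal_powr_mono:
  assumes "a \<le> b" and "r \<ge> 0"
  shows "ennreal_powr a r \<le> ennreal_powr b r"
  using assms
  by (auto simp: ennreal_powr_def top_unique less_top intro!: ennreal_leI powr_mono2 enn2real_mono)

section \<open>Rigidity at and above the critical exponent\<close>

theorem corollary1p4:
  fixes u :: "real ^ 'n \<Rightarrow> real" and s p q :: real
  assumes "CARD('n) \<ge> 2"
    and "0 < s" and "s < 1"
    and "0 < p"
    and "s * p < real CARD('n)"
    and "real CARD('n) * p / (real CARD('n) - s * p) \<le> q"
    and "u \<in> hom_Sobolev s p q"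
  shows "\<exists>K::real. AE x in lebesgue. u x = K"
proof (rule ccontr)
  assume not_const: "\<not> (\<exists>K::real. AE x in lebesgue. u x = K)"
  define n where "n = real CARD('n)"
  define r where "r = n + s * q"
  define I where "I = (\<lambda>x. \<integral>\<^sup>+ y. ennreal (\<bar>u x - u y\<bar> powr q / norm (x - y) powr r) \<partial>lebesgue)"
  have u: "u \<in> borel_measurable lebesgue"
    and fin: "(\<integral>\<^sup>+ x. ennreal_powr (I x) (p / q) \<partial>lebesgue) < \<infinity>"
    using assms(7) unfolding hom_Sobolev_def I_def r_def n_def by auto
  have n: "n > 0" unfolding n_def by simp
  have sp: "s * p < n" using assms(5) by (simp add: n_def)
  have np: "n * p \<le> q * (n - s * p)"
    using assms(6) sp unfolding n_def[symmetric] by (simp add: pos_divide_le_eq)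
  have "0 < n * p / (n - s * p)" using n sp \<open>0 < p\<close> by simp
  then have q: "q > 0" using assms(6) unfolding n_def[symmetric] by linarith
  have r: "r > 0" using n q \<open>0 < s\<close> by (simp add: r_def add_pos_pos)
  have exponent: "r * (p / q) \<le> n"
    using np q unfolding r_def by (simp add: field_simps)
  from not_const AE_const_or_level_gap[where M=lebesgue and u=u] obtain a b where ab: "a < b"
    "\<not> (AE x in lebesgue. a < u x)" "\<not> (AE x in lebesgue. u x < b)" by blast
  obtain N1 :: nat where N1: "\<And>R. R \<ge> real N1 \<Longrightarrow> \<not> (AE x in lebesgue. \<not> (norm x < R \<and> u x \<le> a))"
    using not_AE_on_some_ball[where M=lebesgue and P="\<lambda>x. u x \<le> a"] ab(2) by (auto simp: not_le)
  obtain N2 :: nat where N2: "\<And>R. R \<ge> real N2 \<Longrightarrow> \<not> (AE x in lebesgue. \<not> (norm x < R \<and> b \<le> u x))"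
    using not_AE_on_some_ball[where M=lebesgue and P="\<lambda>x. b \<le> u x"] ab(3) by (auto simp: not_le)
  \<comment> \<open>\<open>R \<ge> 1\<close> makes \<open>norm x + R \<ge> 1\<close>, so its powers increase with the exponent.\<close>
  define R where "R = max 1 (max (real N1) (real N2))"
  have R: "R \<ge> 1" "R \<ge> real N1" "R \<ge> real N2" by (auto simp: R_def)
  obtain m where m: "m > 0" "\<And>x. ennreal (m / (norm x + R) powr r) \<le> I x"
    using inner_integral_lower_bound[OF u ab(1) q r _ N1[OF R(2)] N2[OF R(3)]] R(1)
    unfolding I_def by auto
  define c where "c = m powr (p / q)"
  have c: "c > 0" using m by (simp add: c_def)
  have lower: "ennreal c * ennreal (1 / (norm x + R) ^ DIM(real ^ 'n)) \<le> ennreal_powr (I x) (p / q)" for x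
  proof -
    have t: "norm x + R \<ge> 1" using R(1) norm_ge_zero[of x] by linarith
    have "(norm x + R) powr (r * (p / q)) \<le> (norm x + R) powr n"
      using t exponent by (intro powr_mono)
    also have "\<dots> = (norm x + R) ^ DIM(real ^ 'n)"
      using t by (simp add: n_def powr_realpow)
    finally have "c / (norm x + R) ^ DIM(real ^ 'n) \<le> c / (norm x + R) powr (r * (p / q))"
      using c t by (intro divide_left_mono) auto
    also have "\<dots> = (m / (norm x + R) powr r) powr (p / q)"
      using m t by (simp add: c_def powr_divide powr_powr)
    finally have "ennreal (c / (norm x + R) ^ DIM(real ^ 'n))
        \<le> ennreal_powr (ennreal (m / (norm x + R) powr r)) (p / q)"
      using m by (simp add: ennreal_powr_def ennreal_leI)
    also have "\<dots> \<le> ennreal_powr (I x) (p / q)"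
      using m(2) \<open>0 < p\<close> q by (intro ennreal_powr_mono) auto
    finally show ?thesis
      using c t by (subst ennreal_mult[symmetric]) auto
  qed
  have meas: "(\<lambda>x::real^'n. ennreal (1 / (norm x + R) ^ DIM(real ^ 'n))) \<in> borel_measurable lborel"
    by measurable
  have "\<infinity> = ennreal c * (\<integral>\<^sup>+ x. ennreal (1 / (norm (x::real^'n) + R) ^ DIM(real ^ 'n)) \<partial>lborel)"
    using nn_integral_inverse_norm_power_DIM[where ?'a = "real^'n", of R] R(1) c
    by (simp add: ennreal_mult_top)
  also have "\<dots> = (\<integral>\<^sup>+ x. ennreal c * ennreal (1 / (norm (x::real^'n) + R) ^ DIM(real ^ 'n)) \<partial>lebesgue)"
    using meas by (simp add: nn_integral_cmult nn_integral_completion)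
  also have "\<dots> \<le> (\<integral>\<^sup>+ x. ennreal_powr (I x) (p / q) \<partial>lebesgue)"
    by (intro nn_integral_mono lower)
  finally show False using fin by simp
qed

end
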